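(* Let $T>0$, $1\le p,q<\infty$, let $\mathcal{X},\mathcal{Y}$ be Banach spaces, $\mathbb{X}:=L^p(0,T;\mathcal{X})$ and $\mathbb{Y}:=L^q(0,T;\mathcal{Y})$. Let $K:\mathcal{X}\to\mathcal{Y}$ be a compact linear operator and let $S(t)\in\mathcal{L}(\mathcal{Y})$, $t\in[0,T]$, be bounded linear operators with $\sup_{t\in(0,T)}\|S(t)\|\le c_S$ for a constant $c_S>0$. Let $F:\mathbb{X}\to\mathbb{Y}$ be given by $(F\vartheta)(t)=S(t)K[\vartheta(t)]$, and for $t_0\in[0,T]$ let $F_{t_0}:\mathcal{X}\to\mathcal{Y}$, $F_{t_0}(x)=S(t_0)K[x]$. If $\dim(F_{t_0}(\mathcal{X}))=\infty$ for all $t_0\in[0,T]$, then the inverse problem $F(\vartheta)=y$ is temporally ill-posed for all $t_0\in[0,T]$, that is, for every $t_0\in[0,T]$ the operator equation $F_{t_0}(\tilde\vartheta)=\tilde y$ is locally ill-posed.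
   Context: $L^p(0,T;\mathcal{X})$ denotes the Lebesgue-Bochner space of strongly measurable functions $u:(0,T)\to\mathcal{X}$ with $\int_0^T\|u(t)\|_{\mathcal{X}}^p\,\mathrm{d}t<\infty$. Temporal ill-posedness: the inverse problem $F(\vartheta)=y$ is temporally (locally) ill-posed if there is a set $\Sigma\subset(0,T)$ of positive measure such that for almost every $t_0\in\Sigma$ the equation $F_{t_0}(\tilde\vartheta)=\tilde y$, $F_{t_0}:\mathcal{D}(F_{t_0})\subseteq\mathcal{X}\to\mathcal{Y}$, is locally ill-posed. Here $\mathcal{D}(F_{t_0})=\{\vartheta(t_0):\vartheta\in C([0,T];\mathcal{X})\cap\mathcal{D}(F)\}$ (which is all of $\mathcal{X}$ when $\mathcal{D}(F)=\mathbb{X}$) and $\tilde y\in F_{t_0}(\mathcal{D}(F_{t_0}))$. Local ill-posedness at a solution $\tilde\vartheta^+$ (i.e. $F_{t_0}(\tilde\vartheta^+)=\tilde y$) means: for all $\rho>0$ there is a sequence $\{\tilde\vartheta_k^{(\rho)}\}_{k\in\mathbb{N}}\subseteq B_\rho^{\mathcal{X}}(\tilde\vartheta^+)\cap\mathcal{D}(F_{t_0})$ such that $\|\tilde\vartheta_k^{(\rho)}-\tilde\vartheta^+\|_{\mathcal{X}}\not\to0$ but $\|F_{t_0}(\tilde\vartheta_k^{(\rho)})-F_{t_0}(\tilde\vartheta^+)\|_{\mathcal{Y}}\to0$ as $k\to\infty$. *)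

theory Defs
  imports "HOL-Analysis.Analysis"
begin

(* Strong (Bochner) measurability. For a non-separable range space this is stronger than
   membership in borel_measurable, which is why the latter is not used. *)
definition strongly_measurable ::
    "'t measure \<Rightarrow> ('t \<Rightarrow> 'x::real_normed_vector) \<Rightarrow> bool" where
  "strongly_measurable M u \<longleftrightarrow>
    (\<exists>s. (\<forall>i::nat. simple_function M (s i)) \<and>
         (AE t in M. (\<lambda>i. s i t) \<longlonglongrightarrow> u t))"

(* L^p(0,T;X) as the set of all representatives, i.e. without passing to classes modulo
   equality almost everywhere. The set is closed under changes on null sets; in particular
   values outside (0,T), including those at 0 and T, are unconstrained. *)
definition lebesgue_bochner ::
    "real \<Rightarrow> real \<Rightarrow> (real \<Rightarrow> 'x::real_normed_vector) set" where
  "lebesgue_bochner p T =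
    {u. strongly_measurable (lebesgue_on {0<..<T}) u \<and>
        (\<integral>\<^sup>+ t. ennreal (norm (u t) powr p) \<partial>lebesgue_on {0<..<T}) < \<infinity>}"

definition compact_operator ::
    "('x::real_normed_vector \<Rightarrow> 'y::real_normed_vector) \<Rightarrow> bool" where
  "compact_operator K \<longleftrightarrow> linear K \<and> (\<forall>B. bounded B \<longrightarrow> compact (closure (K ` B)))"

(* The library function dim returns 0 on infinite-dimensional subspaces, so it cannot
   express dim V = \<infinity>. *)
definition infinite_dimensional :: "'y::real_vector set \<Rightarrow> bool" where
  "infinite_dimensional V \<longleftrightarrow> \<not> (\<exists>B. finite B \<and> B \<subseteq> V \<and> V \<subseteq> span B)"

definition locally_ill_posed_at ::
    "'x::real_normed_vector set \<Rightarrow> ('x \<Rightarrow> 'y::real_normed_vector) \<Rightarrow> 'x \<Rightarrow> bool" where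
  "locally_ill_posed_at D G x \<longleftrightarrow>
    (\<forall>\<rho>>0. \<exists>\<xi> :: nat \<Rightarrow> 'x.
        (\<forall>k. \<xi> k \<in> ball x \<rho> \<inter> D) \<and>
        \<not> (\<lambda>k. norm (\<xi> k - x)) \<longlonglongrightarrow> 0 \<and>
        (\<lambda>k. norm (G (\<xi> k) - G x)) \<longlonglongrightarrow> 0)"

(* The equation G x = y, x in D, is locally ill-posed: this is required at each of its
   solutions. It is only used for y in G ` D, so that a solution exists. *)
definition locally_ill_posed ::
    "'x::real_normed_vector set \<Rightarrow> ('x \<Rightarrow> 'y::real_normed_vector) \<Rightarrow> 'y \<Rightarrow> bool" where
  "locally_ill_posed D G y \<longleftrightarrow> (\<forall>x\<in>D. G x = y \<longrightarrow> locally_ill_posed_at D G x)"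

(* The domain of F_t, obtained from the domain DF of F by evaluating its continuous
   members at time t. *)
definition pointwise_domain ::
    "real \<Rightarrow> (real \<Rightarrow> 'x::real_normed_vector) set \<Rightarrow> real \<Rightarrow> 'x set" where
  "pointwise_domain T DF t = {\<theta> t |\<theta>. continuous_on {0..T} \<theta> \<and> \<theta> \<in> DF}"

(* The inverse problem enters through the domain DF of F and the family Ft of pointwise
   operators; the right-hand side ranges over all attainable data. *)
definition temporally_ill_posed ::
    "real \<Rightarrow> (real \<Rightarrow> 'x::real_normed_vector) set \<Rightarrow>
     (real \<Rightarrow> 'x \<Rightarrow> 'y::real_normed_vector) \<Rightarrow> bool" where
  "temporally_ill_posed T DF Ft \<longleftrightarrow>
    (\<exists>\<Sigma>. \<Sigma> \<subseteq> {0<..<T} \<and> \<Sigma> \<in> sets lebesgue \<and> emeasure lebesgue \<Sigma> > 0 \<and>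
      (AE t in lebesgue. t \<in> \<Sigma> \<longrightarrow>
        (\<forall>y \<in> Ft t ` pointwise_domain T DF t.
           locally_ill_posed (pointwise_domain T DF t) (Ft t) y)))"

end

theory Submission
  imports Defs
begin

text \<open>
  Constant functions of time belong to the Lebesgue-Bochner space because the interval has finite
  length, so every pointwise domain is the whole space, and what remains is a statement about a
  single operator \<open>G = S(t) K\<close> between Banach spaces. This operator is linear and compact.

  A linear operator is locally ill-posed at every point as soon as it is not bounded below: if unit
  vectors can have arbitrarily small images, then perturbing a solution by vectors of fixed length
  \<open>\<rho> / 2\<close> changes the data by as little as desired
  (\<open>locally_ill_posed_at_if_not_bounded_below\<close>). It therefore suffices that a compact operator
  which is bounded below has finite-dimensional range. Such an operator pulls convergent
  subsequences of images back to convergent subsequences of arguments, so the closed unit ball of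
  the domain is compact (\<open>compact_cball_if_bounded_below\<close>); by Riesz's theorem the domain is
  finite-dimensional (\<open>finite_dimensional_if_compact_cball\<close>), and so is the range.
\<close>

section \<open>Finite-dimensional subspaces and Riesz's theorem\<close>

text \<open>
  If \<open>b\<close> is outside the closed subspace \<open>V\<close>, it has positive distance \<open>d\<close> from \<open>V\<close>, hence
  \<open>norm (v + a b) \<ge> \<bar>a\<bar> d\<close> for \<open>v \<in> V\<close>. Along a convergent sequence in the enlarged span the
  coefficients of \<open>b\<close> are then a Cauchy sequence of reals, and the components in \<open>V\<close> converge too.
\<close>

lemma closed_span_insert:
  fixes V :: "'a::real_normed_vector set"
  assumes V: "subspace V" and cl: "closed V"
  shows "closed (span (insert b V))"
proof (cases "b \<in> V")
  case True
  then have "span (insert b V) = V"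
    using V by (simp add: insert_absorb span_eq_iff)
  then show ?thesis using cl by simp
next
  case False
  have ne: "V \<noteq> {}" using subspace_0[OF V] by blast
  have in_span: "x \<in> span (insert b V) \<longleftrightarrow> (\<exists>k. x - k *\<^sub>R b \<in> V)" for x
    unfolding span_insert span_eq_iff[THEN iffD2, OF V] by simp
  define d where "d = infdist b V"
  have d: "d > 0"
    using False cl ne in_closed_iff_infdist_zero[OF cl ne] infdist_nonneg[of b V]
    by (auto simp: d_def less_le)
  have lower: "\<bar>a\<bar> * d \<le> norm (v + a *\<^sub>R b)" if v: "v \<in> V" for a v
  proof (cases "a = 0")
    case False
    have "- (inverse a *\<^sub>R v) \<in> V"
      using V v by (intro subspace_neg subspace_scale)
    then have "d \<le> dist b (- (inverse a *\<^sub>R v))"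
      unfolding d_def by (rule infdist_le)
    then have "\<bar>a\<bar> * d \<le> \<bar>a\<bar> * norm (b + inverse a *\<^sub>R v)"
      by (intro mult_left_mono) (auto simp: dist_norm)
    also have "\<dots> = norm (a *\<^sub>R (b + inverse a *\<^sub>R v))" by simp
    also have "a *\<^sub>R (b + inverse a *\<^sub>R v) = v + a *\<^sub>R b"
      using False by (simp add: scaleR_add_right)
    finally show ?thesis .
  qed simp
  show ?thesis
  proof (subst closed_sequential_limits, intro allI impI, elim conjE)
    fix w l assume w: "\<forall>n. w n \<in> span (insert b V)" and l: "w \<longlonglongrightarrow> l"
    have "\<forall>n. \<exists>k. w n - k *\<^sub>R b \<in> V"
      using w in_span by blast
    then obtain a where a: "\<And>n. w n - a n *\<^sub>R b \<in> V" by metis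
    have step: "\<bar>a m - a n\<bar> * d \<le> dist (w m) (w n)" for m n
    proof -
      have "(w m - a m *\<^sub>R b) - (w n - a n *\<^sub>R b) \<in> V"
        using subspace_diff[OF V a a] .
      from lower[OF this, of "a m - a n"] show ?thesis
        by (simp add: dist_norm algebra_simps)
    qed
    have "Cauchy a"
    proof (rule metric_CauchyI)
      fix e :: real assume "e > 0"
      then have "e * d > 0" using d by simp
      then obtain N where N: "\<forall>m\<ge>N. \<forall>n\<ge>N. dist (w m) (w n) < e * d"
        using LIMSEQ_imp_Cauchy[OF l] unfolding Cauchy_def by blast
      have "dist (a m) (a n) < e" if "m \<ge> N" "n \<ge> N" for m n
      proof -
        have "\<bar>a m - a n\<bar> * d < e * d" using step[of m n] N that by force
        then show ?thesis using d by (simp add: dist_real_def)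
      qed
      then show "\<exists>M. \<forall>m\<ge>M. \<forall>n\<ge>M. dist (a m) (a n) < e" by blast
    qed
    then obtain k where k: "a \<longlonglongrightarrow> k"
      using Cauchy_convergent convergent_def by blast
    have "(\<lambda>n. w n - a n *\<^sub>R b) \<longlonglongrightarrow> l - k *\<^sub>R b"
      using l k by (intro tendsto_intros)
    then have "l - k *\<^sub>R b \<in> V"
      by (rule closed_sequentially[OF cl a])
    then show "l \<in> span (insert b V)"
      using in_span by blast
  qed
qed

lemma closed_span_finite:
  fixes B :: "'a::real_normed_vector set"
  assumes "finite B"
  shows "closed (span B)"
  using assms
proof (induction B rule: finite_induct)
  case (insert b B)
  have "span (insert b (span B)) = span (insert b B)"
    by (simp add: span_insert span_span)
  then show ?case
    using closed_span_insert[OF subspace_span insert.IH, of b] by simp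
qed simp

text \<open>
  Riesz's argument: cover the unit ball by finitely many balls of radius \<open>1/2\<close> and let \<open>V\<close> be the
  span of their centres, a closed subspace. For \<open>x\<close> outside \<open>V\<close>, take \<open>v \<in> V\<close>
  less than twice as far from \<open>x\<close> as \<open>V\<close> is. Correcting \<open>v\<close> by a centre close to the direction
  of \<open>x - v\<close> more than halves its distance to \<open>x\<close>, giving a point of \<open>V\<close> that is too near.
\<close>

lemma finite_dimensional_if_compact_cball:
  assumes "compact (cball (0::'a::real_normed_vector) 1)"
  shows "\<exists>B. finite B \<and> span B = (UNIV :: 'a set)"
proof -
  have "cball (0::'a) 1 \<subseteq> (\<Union>b\<in>cball 0 1. ball b (1/2))"
    by (intro subsetI UN_I[of x _ x for x]) auto
  then obtain B where B: "finite B" "cball (0::'a) 1 \<subseteq> (\<Union>b\<in>B. ball b (1/2))"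
    by (rule compactE_image[OF assms open_ball]) blast
  let ?V = "span B"
  have cl: "closed ?V" by (rule closed_span_finite[OF B(1)])
  have ne: "?V \<noteq> {}" using span_zero by blast
  have "x \<in> ?V" for x
  proof (rule ccontr)
    assume x: "x \<notin> ?V"
    define d where "d = infdist x ?V"
    have d: "d > 0"
      using x in_closed_iff_infdist_zero[OF cl ne] infdist_nonneg[of x ?V]
      by (auto simp: d_def less_le)
    obtain v where v: "v \<in> ?V" "dist x v < 2 * d"
    proof -
      have "infdist x ?V < 2 * d" using d by (simp add: d_def)
      then show thesis
        using that ne infdist_notempty[OF ne, of x] cINF_less_iff[OF ne, of "dist x" "2 * d"]
        by auto
    qed
    define r where "r = norm (x - v)"
    have r: "r > 0" "r < 2 * d" using x v by (auto simp: r_def dist_norm)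
    have "inverse r *\<^sub>R (x - v) \<in> cball 0 1" using r by (simp add: r_def)
    then obtain b where b: "b \<in> B" "norm (b - inverse r *\<^sub>R (x - v)) < 1/2"
      using B by (force simp: dist_norm)
    have "v + r *\<^sub>R b \<in> ?V"
      by (intro span_add span_scale v(1) span_base b(1))
    then have "d \<le> dist x (v + r *\<^sub>R b)" unfolding d_def by (rule infdist_le)
    also have "\<dots> = norm (r *\<^sub>R (b - inverse r *\<^sub>R (x - v)))"
      using r by (simp add: dist_norm norm_minus_commute algebra_simps)
    also have "\<dots> = r * norm (b - inverse r *\<^sub>R (x - v))" using r by simp
    also have "\<dots> < r * (1/2)" using b r by (intro mult_strict_left_mono)
    also have "\<dots> < d" using r by simp
    finally have "d < d" .
    then show False by simp
  qed
  then show ?thesis using B by blast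
qed

section \<open>Compact operators\<close>

text \<open>
  The lower bound turns Cauchy sequences of images into Cauchy sequences of arguments, which
  converge because the domain is complete.
\<close>

lemma compact_cball_if_bounded_below:
  fixes G :: "'x::banach \<Rightarrow> 'y::real_normed_vector"
  assumes G: "compact_operator G" and c: "c > 0" "\<And>x. c * norm x \<le> norm (G x)"
  shows "compact (cball (0::'x) 1)"
  unfolding compact_def
proof (intro allI impI)
  fix f :: "nat \<Rightarrow> 'x" assume f: "\<forall>n. f n \<in> cball 0 1"
  have lin: "linear G" and comp: "compact (closure (G ` cball 0 1))"
    using G by (auto simp: compact_operator_def)
  have "\<forall>n. (G \<circ> f) n \<in> closure (G ` cball 0 1)"
    using f closure_subset by fastforce
  then obtain l r where r: "strict_mono (r :: nat \<Rightarrow> nat)" "((G \<circ> f) \<circ> r) \<longlonglongrightarrow> l"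
    using comp unfolding compact_def by blast
  have "Cauchy (f \<circ> r)"
  proof (rule metric_CauchyI)
    fix e :: real assume "e > 0"
    then have "c * e > 0" using c by simp
    then obtain N where
      N: "\<forall>m\<ge>N. \<forall>n\<ge>N. dist (((G \<circ> f) \<circ> r) m) (((G \<circ> f) \<circ> r) n) < c * e"
      using LIMSEQ_imp_Cauchy[OF r(2)] unfolding Cauchy_def by blast
    have "dist ((f \<circ> r) m) ((f \<circ> r) n) < e" if "m \<ge> N" "n \<ge> N" for m n
    proof -
      have "c * norm (f (r m) - f (r n)) \<le> norm (G (f (r m)) - G (f (r n)))"
        using c(2)[of "f (r m) - f (r n)"] by (simp add: linear_diff[OF lin])
      also have "\<dots> < c * e" using N that by (simp add: dist_norm)
      finally show ?thesis using c by (simp add: dist_norm)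
    qed
    then show "\<exists>M. \<forall>m\<ge>M. \<forall>n\<ge>M. dist ((f \<circ> r) m) ((f \<circ> r) n) < e" by blast
  qed
  then obtain x where x: "(f \<circ> r) \<longlonglongrightarrow> x"
    using Cauchy_convergent convergent_def by blast
  have "x \<in> cball 0 1"
    using closed_sequentially[OF closed_cball _ x, of 0 1] f by simp
  then show "\<exists>l\<in>cball 0 1. \<exists>r. strict_mono r \<and> (f \<circ> r) \<longlonglongrightarrow> l"
    using x r by blast
qed

lemma compact_operator_not_bounded_below:
  fixes G :: "'x::banach \<Rightarrow> 'y::real_normed_vector"
  assumes G: "compact_operator G" and inf: "infinite_dimensional (range G)" and c: "c > 0"
  shows "\<exists>x. norm (G x) < c * norm x"
proof (rule ccontr)
  assume "\<not> ?thesis"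
  then have "\<And>x. c * norm x \<le> norm (G x)" by (simp add: not_less)
  from finite_dimensional_if_compact_cball[OF compact_cball_if_bounded_below[OF G c this]]
  obtain B where B: "finite B" "span B = (UNIV :: 'x set)" by blast
  have "linear G" using G by (simp add: compact_operator_def)
  then have "range G = span (G ` B)" using B linear_span_image by metis
  then have "finite (G ` B) \<and> G ` B \<subseteq> range G \<and> range G \<subseteq> span (G ` B)"
    using B by auto
  then show False using inf unfolding infinite_dimensional_def by blast
qed

lemma compact_operator_blinfun_compose:
  fixes K :: "'x::real_normed_vector \<Rightarrow> 'y::real_normed_vector"
    and A :: "'y \<Rightarrow>\<^sub>L 'z::real_normed_vector"
  assumes "compact_operator K"
  shows "compact_operator (\<lambda>x. blinfun_apply A (K x))"
  unfolding compact_operator_def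
proof (intro conjI allI impI)
  have "linear K" using assms by (simp add: compact_operator_def)
  moreover have "linear (blinfun_apply A)"
    using blinfun.bounded_linear_right bounded_linear.linear by blast
  ultimately show "linear (\<lambda>x. blinfun_apply A (K x))"
    using linear_compose[of K "blinfun_apply A"] by (simp add: o_def)
next
  fix B :: "'x set" assume "bounded B"
  then have "compact (closure (K ` B))" using assms by (simp add: compact_operator_def)
  then have comp: "compact (blinfun_apply A ` closure (K ` B))"
    by (intro compact_continuous_image continuous_intros)
  have "(\<lambda>x. blinfun_apply A (K x)) ` B \<subseteq> blinfun_apply A ` closure (K ` B)"
    using closure_subset[of "K ` B"] by blast
  then have "closure ((\<lambda>x. blinfun_apply A (K x)) ` B) \<subseteq> blinfun_apply A ` closure (K ` B)"
    using comp by (intro closure_minimal compact_imp_closed)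
  then show "compact (closure ((\<lambda>x. blinfun_apply A (K x)) ` B))"
    using compact_Int_closed[OF comp closed_closure] by (metis inf.absorb2)
qed

section \<open>Local ill-posedness\<close>

text \<open>
  The definition asks for data that converge while the arguments stay away from the solution.
  Normalising near-violations of a lower bound to length \<open>\<rho> / 2\<close> achieves this inside the ball of
  radius \<open>\<rho>\<close>; by linearity the same perturbations serve at every point.
\<close>

lemma locally_ill_posed_at_if_not_bounded_below:
  fixes G :: "'x::real_normed_vector \<Rightarrow> 'y::real_normed_vector"
  assumes lin: "linear G" and small: "\<And>c. c > 0 \<Longrightarrow> \<exists>x. norm (G x) < c * norm x"
  shows "locally_ill_posed_at UNIV G x"
  unfolding locally_ill_posed_at_def
proof (intro allI impI)
  fix \<rho> :: real assume \<rho>: "\<rho> > 0"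
  have "\<exists>h. norm h = \<rho> / 2 \<and> norm (G h) < \<rho> / 2 * inverse (real (Suc n))" for n
  proof -
    obtain z where z: "norm (G z) < inverse (real (Suc n)) * norm z"
      using small[of "inverse (real (Suc n))"] by auto
    have z0: "norm z > 0"
      using z linear_0[OF lin] by (cases "z = 0") auto
    let ?h = "(\<rho> / 2 / norm z) *\<^sub>R z"
    have "norm (G ?h) = \<rho> / 2 / norm z * norm (G z)"
      using \<rho> by (simp add: linear_scale[OF lin])
    also have "\<dots> < \<rho> / 2 / norm z * (inverse (real (Suc n)) * norm z)"
      using z z0 \<rho> by (intro mult_strict_left_mono) auto
    also have "\<dots> = \<rho> / 2 * inverse (real (Suc n))" using z0 by simp
    finally have "norm (G ?h) < \<rho> / 2 * inverse (real (Suc n))" .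
    moreover have "norm ?h = \<rho> / 2" using z0 \<rho> by simp
    ultimately show ?thesis by blast
  qed
  then obtain h where h: "\<And>n. norm (h n) = \<rho> / 2"
    "\<And>n. norm (G (h n)) < \<rho> / 2 * inverse (real (Suc n))" by metis
  have "(\<lambda>n. \<rho> / 2 * inverse (real (Suc n))) \<longlonglongrightarrow> 0"
    using tendsto_mult_right_zero[OF LIMSEQ_inverse_real_of_nat] .
  then have "(\<lambda>n. norm (G (h n))) \<longlonglongrightarrow> 0"
    by (rule tendsto_sandwich[OF _ _ tendsto_const, rotated 2])
      (intro always_eventually allI norm_ge_zero less_imp_le[OF h(2)])+
  moreover have "\<not> (\<lambda>n. norm (h n)) \<longlonglongrightarrow> 0"
    using \<rho> by (simp add: h(1) LIMSEQ_const_iff)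
  moreover have "x + h n \<in> ball x \<rho> \<inter> UNIV" for n
    using \<rho> h(1)[of n] by (simp add: dist_norm)
  ultimately show "\<exists>\<xi>. (\<forall>k. \<xi> k \<in> ball x \<rho> \<inter> UNIV) \<and>
      \<not> (\<lambda>k. norm (\<xi> k - x)) \<longlonglongrightarrow> 0 \<and> (\<lambda>k. norm (G (\<xi> k) - G x)) \<longlonglongrightarrow> 0"
    by (intro exI[of _ "\<lambda>n. x + h n"]) (simp add: linear_add[OF lin])
qed

section \<open>Pointwise domains\<close>

lemma const_in_lebesgue_bochner: "(\<lambda>t. x) \<in> lebesgue_bochner p T"
proof -
  have "strongly_measurable (lebesgue_on {0<..<T}) (\<lambda>t. x)"
    unfolding strongly_measurable_def by (intro exI[of _ "\<lambda>i t. x"]) simp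
  moreover have "emeasure (lebesgue_on {0<..<T}) (space (lebesgue_on {0<..<T})) < \<infinity>"
    by (cases "T \<ge> 0") (simp_all add: emeasure_restrict_space)
  ultimately show ?thesis
    unfolding lebesgue_bochner_def by (simp add: ennreal_mult_less_top)
qed

lemma pointwise_domain_lebesgue_bochner:
  "pointwise_domain T (lebesgue_bochner p T) t = UNIV"
  using const_in_lebesgue_bochner unfolding pointwise_domain_def
  by (auto intro!: exI[of _ "\<lambda>t. x" for x])

theorem proposition3p3:
  fixes T p q cS :: real
    and K :: "'x::banach \<Rightarrow> 'y::banach"
    and S :: "real \<Rightarrow> 'y \<Rightarrow>\<^sub>L 'y"
    and F :: "(real \<Rightarrow> 'x) \<Rightarrow> (real \<Rightarrow> 'y)"
    and Ft :: "real \<Rightarrow> 'x \<Rightarrow> 'y"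
  assumes "T > 0" and "p \<ge> 1" and "q \<ge> 1"
    and "compact_operator K"
    and "cS > 0" and "\<forall>t\<in>{0<..<T}. norm (S t) \<le> cS"
    and "F \<in> lebesgue_bochner p T \<rightarrow> lebesgue_bochner q T"
    and "\<forall>\<theta>\<in>lebesgue_bochner p T.
           AE t in lebesgue_on {0<..<T}. F \<theta> t = blinfun_apply (S t) (K (\<theta> t))"
    and "\<forall>t\<in>{0..T}. \<forall>x. Ft t x = blinfun_apply (S t) (K x)"
    and "\<forall>t\<in>{0..T}. infinite_dimensional (range (Ft t))"
  shows "temporally_ill_posed T (lebesgue_bochner p T) Ft \<and>
    (\<forall>t\<in>{0..T}. \<forall>y \<in> Ft t ` pointwise_domain T (lebesgue_bochner p T) t.
       locally_ill_posed (pointwise_domain T (lebesgue_bochner p T) t) (Ft t) y)"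
proof -
  have ill: "locally_ill_posed UNIV (Ft t) y" if t: "t \<in> {0..T}" for t y
  proof -
    have "Ft t = (\<lambda>x. blinfun_apply (S t) (K x))" using assms(9) t by auto
    then have comp: "compact_operator (Ft t)"
      using compact_operator_blinfun_compose[OF assms(4)] by simp
    then have lin: "linear (Ft t)" by (simp add: compact_operator_def)
    have "infinite_dimensional (range (Ft t))" using assms(10) t by blast
    then have "locally_ill_posed_at UNIV (Ft t) x" for x
      by (intro locally_ill_posed_at_if_not_bounded_below[OF lin]
          compact_operator_not_bounded_below[OF comp])
    then show ?thesis by (simp add: locally_ill_posed_def)
  qed
  have "temporally_ill_posed T (lebesgue_bochner p T) Ft"
    unfolding temporally_ill_posed_def pointwise_domain_lebesgue_bochner
    using assms(1) ill by (intro exI[of _ "{0<..<T}"]) auto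
  then show ?thesis
    unfolding pointwise_domain_lebesgue_bochner using ill by blast
qed

end
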